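(* Let $M$ be a line $K_3$-free graph. Then $M$ has an EFL coloring with $w(M)$ colors.
   Context: $M$ is a finite set of distinct lines in the plane. $P(M)$ is the set of points lying on at least two lines of $M$. $G_M$ is the graph with vertex set $P(M)$ in which $u,v$ are adjacent iff some line of $M$ contains both and no point of $P(M)$ lies on that line strictly between $u$ and $v$. $M$ is a line $K_3$-free graph if $G_M$ has no subgraph isomorphic to $K_3$. For $s\in M$, $p(s,M)$ is the number of points of $P(M)$ on $s$, and $w(M)=\max_{s\in M}p(s,M)$. An EFL coloring of $M$ with $k$ colors is a function $f:P(M)\rightarrow\{1,\ldots,k\}$ such that any two distinct intersection points lying on a common line of $M$ receive different colors. *)

theory Defs
  imports "HOL-Analysis.Analysis" "Graph_Theory.Kuratowski"
begin

definition is_line :: "(real^2) set \<Rightarrow> bool" where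
  "is_line s \<longleftrightarrow> affine s \<and> aff_dim s = 1"

definition line_arrangement :: "(real^2) set set \<Rightarrow> bool" where
  "line_arrangement M \<longleftrightarrow> finite M \<and> (\<forall>s\<in>M. is_line s)"

definition inter_points :: "(real^2) set set \<Rightarrow> (real^2) set" where
  "inter_points M = {x. \<exists>s\<in>M. \<exists>t\<in>M. s \<noteq> t \<and> x \<in> s \<and> x \<in> t}"

definition line_adjacent :: "(real^2) set set \<Rightarrow> real^2 \<Rightarrow> real^2 \<Rightarrow> bool" where
  "line_adjacent M u v \<longleftrightarrow> u \<noteq> v \<and>
     (\<exists>s\<in>M. u \<in> s \<and> v \<in> s \<and> \<not> (\<exists>x\<in>inter_points M. x \<in> s \<and> x \<in> open_segment u v))"

text \<open>Undirected graphs are symmetric digraphs: each edge is the pair of its two opposite arcs.\<close>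

definition line_graph :: "(real^2) set set \<Rightarrow> (real^2) pair_pre_digraph" where
  "line_graph M = \<lparr> pverts = inter_points M,
     parcs = {(u, v). u \<in> inter_points M \<and> v \<in> inter_points M \<and> line_adjacent M u v} \<rparr>"

definition line_K3_free_graph :: "(real^2) set set \<Rightarrow> bool" where
  "line_K3_free_graph M \<longleftrightarrow> line_arrangement M \<and>
     \<not> (\<exists>H. subgraph H (with_proj (line_graph M)) \<and> complete_digraph 3 H)"

definition points_on :: "(real^2) set \<Rightarrow> (real^2) set set \<Rightarrow> nat" where
  "points_on s M = card {x \<in> inter_points M. x \<in> s}"

text \<open>The value for the empty arrangement is unspecified; it has no intersection points to colour.\<close>

definition max_points_on :: "(real^2) set set \<Rightarrow> nat" where
  "max_points_on M = Max ((\<lambda>s. points_on s M) ` M)"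

definition EFL_coloring :: "(real^2) set set \<Rightarrow> nat \<Rightarrow> (real^2 \<Rightarrow> nat) \<Rightarrow> bool" where
  "EFL_coloring M k f \<longleftrightarrow> (\<forall>x\<in>inter_points M. f x \<in> {1..k}) \<and>
     (\<forall>x\<in>inter_points M. \<forall>y\<in>inter_points M.
        x \<noteq> y \<and> (\<exists>s\<in>M. x \<in> s \<and> y \<in> s) \<longrightarrow> f x \<noteq> f y)"

lemma line_eqI:
  assumes s: "is_line s" and t: "is_line t" and "x \<in> s" "y \<in> s" "x \<in> t" "y \<in> t" "x \<noteq> y"
  shows "s = t"
proof -
  have "r = affine hull {x, y}" if "is_line r" "x \<in> r" "y \<in> r" for r
  proof -
    have sub: "affine hull {x, y} \<subseteq> r"
      using that by (intro hull_minimal) (auto simp: is_line_def)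
    show ?thesis
      by (rule sym, rule affine_dim_equal)
        (use sub that \<open>x \<noteq> y\<close> in \<open>auto simp: is_line_def aff_dim_2\<close>)
  qed
  from this[OF s] this[OF t] assms show ?thesis by simp
qed

lemma finite_inter_points:
  assumes "line_arrangement M"
  shows "finite (inter_points M)"
proof -
  have "finite (s \<inter> t)" if "s \<in> M" "t \<in> M" "s \<noteq> t" for s t
  proof (cases "s \<inter> t = {}")
    case False
    then obtain x where "x \<in> s \<inter> t" by blast
    then have "s \<inter> t \<subseteq> {x}"
      using line_eqI[of s t x] that assms by (auto simp: line_arrangement_def)
    then show ?thesis by (rule finite_subset) simp
  qed simp
  moreover have "inter_points M = (\<Union>s\<in>M. \<Union>t\<in>M - {s}. s \<inter> t)"
    by (auto simp: inter_points_def)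
  moreover have "finite M" using assms by (simp add: line_arrangement_def)
  ultimately show ?thesis by (auto simp del: UN_simps)
qed

lemma line_adjacent_commute: "line_adjacent M u v \<longleftrightarrow> line_adjacent M v u"
  unfolding line_adjacent_def by (subst open_segment_commute) blast

lemma graph_line_graph:
  assumes "line_arrangement M"
  shows "graph (with_proj (line_graph M))"
proof -
  have fin: "finite (inter_points M)" by (rule finite_inter_points[OF assms])
  have arcs: "parcs (line_graph M) \<subseteq> inter_points M \<times> inter_points M"
    by (auto simp: line_graph_def)
  have "pair_graph (line_graph M)"
  proof unfold_locales
    show "finite (parcs (line_graph M))"
      using arcs fin by (meson finite_SigmaI finite_subset)
    show "symmetric (with_proj (line_graph M))"
      unfolding symmetric_def by (rule symI) (simp add: line_graph_def line_adjacent_commute)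
  qed (use fin in \<open>auto simp: line_graph_def line_adjacent_def\<close>)
  then show ?thesis by (rule pair_graph.pair_graphD_graph)
qed

lemma line_K3_free_graph_iff:
  "line_K3_free_graph M \<longleftrightarrow> line_arrangement M \<and>
     \<not> (\<exists>u\<in>inter_points M. \<exists>v\<in>inter_points M. \<exists>w\<in>inter_points M.
          line_adjacent M u v \<and> line_adjacent M v w \<and> line_adjacent M u w)"
proof -
  let ?G = "with_proj (line_graph M)"
  have sym: "line_adjacent M v u" if "line_adjacent M u v" for u v
    using that by (simp add: line_adjacent_commute)
  have "(\<exists>H. subgraph H ?G \<and> complete_digraph 3 H) \<longleftrightarrow>
     (\<exists>u\<in>inter_points M. \<exists>v\<in>inter_points M. \<exists>w\<in>inter_points M.
          line_adjacent M u v \<and> line_adjacent M v w \<and> line_adjacent M u w)"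
    (is "?L \<longleftrightarrow> ?R") if M: "line_arrangement M"
  proof
    assume ?L
    then obtain H where H: "subgraph H ?G" "complete_digraph 3 H" by blast
    then obtain u v w where V: "verts H = {u, v, w}" "u \<noteq> v" "v \<noteq> w" "u \<noteq> w"
      unfolding complete_digraph_def card_3_iff by blast
    have "(u, v) \<in> arcs_ends H" "(v, w) \<in> arcs_ends H" "(u, w) \<in> arcs_ends H"
      using H(2) V unfolding complete_digraph_def by simp_all
    then have "(u, v) \<in> arcs_ends ?G" "(v, w) \<in> arcs_ends ?G" "(u, w) \<in> arcs_ends ?G"
      using arcs_ends_mono[OF H(1)] by blast+
    then have "\<forall>e\<in>{(u, v), (v, w), (u, w)}. e \<in> parcs (line_graph M)" by simp
    then have "u \<in> inter_points M \<and> v \<in> inter_points M \<and> w \<in> inter_points M \<and>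
      line_adjacent M u v \<and> line_adjacent M v w \<and> line_adjacent M u w"
      by (simp add: line_graph_def)
    then show ?R by blast
  next
    assume ?R
    then obtain u v w where uvw: "u \<in> inter_points M" "v \<in> inter_points M" "w \<in> inter_points M"
      "line_adjacent M u v" "line_adjacent M v w" "line_adjacent M u w" by blast
    then have ne: "u \<noteq> v" "v \<noteq> w" "u \<noteq> w" by (auto simp: line_adjacent_def)
    let ?V = "{u, v, w}"
    let ?H = "\<lparr> pverts = ?V, parcs = {(x, y). x \<in> ?V \<and> y \<in> ?V \<and> x \<noteq> y} \<rparr>"
    have K: "complete_digraph 3 (with_proj ?H)"
      unfolding complete_digraph_pair_def using ne by (auto simp: card_insert_if)
    have "wf_digraph (with_proj ?H)"
      by unfold_locales auto
    moreover have "wf_digraph ?G"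
      using graph_line_graph[OF M] by (simp add: graph_def digraph_def fin_digraph_def)
    moreover have "parcs ?H \<subseteq> parcs (line_graph M)"
    proof -
      have "line_adjacent M x y" if "x \<in> ?V" "y \<in> ?V" "x \<noteq> y" for x y
        using that uvw(4-6) sym by blast
      then show ?thesis using uvw(1-3) by (auto simp: line_graph_def)
    qed
    moreover have "pverts ?H \<subseteq> pverts (line_graph M)"
      using uvw(1-3) by (simp add: line_graph_def)
    ultimately have "subgraph (with_proj ?H) ?G"
      by (simp add: subgraph_def compatible_def)
    with K show ?L by blast
  qed
  then show ?thesis unfolding line_K3_free_graph_def by blast
qed

end

theory Submission
  imports Defs "HOL-Number_Theory.Cong"
begin

text \<open>
  If three lines of \<open>M\<close> bound a triangle, choose one whose closed hull contains the fewest points of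
  \<open>P(M)\<close>. A point of \<open>P(M)\<close> inside a side lies on a further line, which by Pasch cuts off a triangle
  containing fewer points; hence the corners are pairwise adjacent, a \<open>K\<^sub>3\<close>. So in a \<open>K\<^sub>3\<close>-free
  arrangement any three pairwise crossing lines are concurrent. It follows that either all lines
  pass through one point, or \<open>M\<close> is a grid formed by two classes of parallel lines. A grid with
  \<open>m\<close> rows and \<open>n\<close> columns is coloured by \<open>(i + j) mod max m n\<close>.
\<close>

section \<open>Lines as hyperplanes, and uniqueness of parallels\<close>

lemma is_line_hyperplane:
  assumes "(n :: real^2) \<noteq> 0"
  shows "is_line {x. n \<bullet> x = c}"
  using assms by (simp add: is_line_def affine_hyperplane aff_dim_hyperplane)

lemma is_line_obtain_hyperplane:
  assumes "is_line s"
  obtains n :: "real^2" and c where "n \<noteq> 0" "s = {x. n \<bullet> x = c}"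
proof -
  have "aff_dim s = int (DIM(real^2) - 1)" using assms by (simp add: is_line_def)
  then obtain n c where "n \<noteq> 0" "affine hull s = {x. n \<bullet> x = c}"
    unfolding aff_dim_eq_hyperplane by blast
  moreover have "affine hull s = s" using assms by (simp add: is_line_def)
  ultimately show ?thesis using that[of n c] by simp
qed

lemma is_line_subset_eq:
  assumes "is_line s" "is_line t" "s \<subseteq> t" "s \<noteq> {}"
  shows "s = t"
  using assms affine_dim_equal[of s t] by (simp add: is_line_def)

lemma line_add_scaled_mem:
  assumes "is_line s" "x \<in> s" "y \<in> s"
  shows "x + k *\<^sub>R (y - x) \<in> s"
proof -
  have "(1 - k) *\<^sub>R x + k *\<^sub>R y \<in> s"
    using assms by (intro mem_affine) (auto simp: is_line_def)
  then show ?thesis by (simp add: algebra_simps)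
qed

text \<open>If the functional \<open>n\<close> were not constant on a line through \<open>x\<close>,
  moving along that line would reach the value \<open>c\<close>, a point of \<open>t\<close>. So
  both lines are the level set of \<open>n\<close> through \<open>x\<close>.\<close>

lemma parallel_line_unique:
  assumes s: "is_line s" and r: "is_line r" and t: "is_line t"
    and x: "x \<in> s" "x \<in> r" and disj: "s \<inter> t = {}" "r \<inter> t = {}"
  shows "s = r"
proof -
  obtain n c where n: "n \<noteq> 0" and t_eq: "t = {x. n \<bullet> x = c}"
    using t by (rule is_line_obtain_hyperplane)
  have "l = {z. n \<bullet> z = n \<bullet> x}" if l: "is_line l" "x \<in> l" "l \<inter> t = {}" for l
  proof (rule is_line_subset_eq[OF l(1) is_line_hyperplane[OF n]])
    show "l \<subseteq> {z. n \<bullet> z = n \<bullet> x}"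
    proof safe
      fix y assume y: "y \<in> l"
      show "n \<bullet> y = n \<bullet> x"
      proof (rule ccontr)
        assume ne: "n \<bullet> y \<noteq> n \<bullet> x"
        define k where "k = (c - n \<bullet> x) / (n \<bullet> (y - x))"
        have "n \<bullet> (x + k *\<^sub>R (y - x)) = c"
          using ne by (simp add: k_def inner_add_right inner_diff_right)
        with line_add_scaled_mem[OF l(1,2) y, of k] l(3) show False by (auto simp: t_eq)
      qed
    qed
  qed (use l in auto)
  from this[OF s x(1) disj(1)] this[OF r x(2) disj(2)] show ?thesis by simp
qed

section \<open>Triangles bounded by lines, and descent to smaller ones\<close>

text \<open>Side \<open>a\<close> is opposite \<open>u\<close>, \<open>b\<close> opposite
  \<open>v\<close>, \<open>c\<close> opposite \<open>w\<close>. The non-incidences make the corners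
  distinct and, for lines, non-collinear; the condition is symmetric in the corners.\<close>

definition line_triangle :: "(real^2) set set \<Rightarrow> real^2 \<Rightarrow> real^2 \<Rightarrow> real^2 \<Rightarrow> bool" where
  "line_triangle M u v w \<longleftrightarrow> (\<exists>a\<in>M. \<exists>b\<in>M. \<exists>c\<in>M.
     u \<notin> a \<and> v \<in> a \<and> w \<in> a \<and> u \<in> b \<and> v \<notin> b \<and> w \<in> b \<and> u \<in> c \<and> v \<in> c \<and> w \<notin> c)"

lemma line_triangle_swap: "line_triangle M u v w \<Longrightarrow> line_triangle M v u w"
  unfolding line_triangle_def by blast

lemma line_triangle_rotate: "line_triangle M u v w \<Longrightarrow> line_triangle M v w u"
  unfolding line_triangle_def by blast

lemma line_triangle_inter_points:
  assumes "line_triangle M u v w"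
  shows "u \<in> inter_points M"
  using assms unfolding line_triangle_def inter_points_def by blast

text \<open>Pasch: \<open>t\<close> separates \<open>u\<close> from \<open>v\<close> and does not
  have \<open>w\<close> strictly on the side of \<open>u\<close>, so it also crosses side
  \<open>uw\<close>, at \<open>y\<close>. The triangle cut off lies on the side of \<open>u\<close>,
  so it misses \<open>v\<close>.\<close>

lemma line_triangle_cut_corner:
  fixes n :: "real^2"
  assumes M: "line_arrangement M"
    and abc: "a \<in> M" "b \<in> M" "c \<in> M" "u \<notin> a" "v \<in> a" "w \<in> a" "u \<in> b" "v \<notin> b" "w \<in> b"
      "u \<in> c" "v \<in> c" "w \<notin> c"
    and t: "t \<in> M" "t = {z. n \<bullet> z = d}"
    and x: "x \<in> open_segment u v" "x \<in> t"
    and sgn: "n \<bullet> u > d" "n \<bullet> v < d" "n \<bullet> w \<le> d"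
  shows "\<exists>y. line_triangle M u x y \<and> convex hull {u, x, y} \<subseteq> convex hull {u, v, w} - {v}"
proof -
  have lines: "is_line l" if "l \<in> M" for l
    using M that by (simp add: line_arrangement_def)
  \<comment> \<open>The parameter at which the way from \<open>u\<close> to \<open>w\<close> reaches
    \<open>t\<close>; \<open>k = 1\<close> when \<open>t\<close> passes through
    \<open>w\<close>.\<close>
  define k where "k = (n \<bullet> u - d) / (n \<bullet> u - n \<bullet> w)"
  have k: "0 < k" "k \<le> 1" using sgn by (auto simp: k_def divide_simps)
  define y where "y = u + k *\<^sub>R (w - u)"
  have "k * (n \<bullet> u - n \<bullet> w) = n \<bullet> u - d" using sgn by (simp add: k_def)
  then have y_t: "y \<in> t"
    by (simp add: t(2) y_def inner_add_right inner_diff_right algebra_simps)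
  have y_b: "y \<in> b"
    unfolding y_def using abc lines by (intro line_add_scaled_mem) auto
  have u_t: "u \<notin> t" using sgn by (simp add: t(2))
  have "u \<noteq> x" "u \<noteq> y" using u_t x y_t by auto
  have x_c: "x \<in> c"
  proof -
    obtain j where "x = (1 - j) *\<^sub>R u + j *\<^sub>R v" using x(1) by (auto simp: in_segment)
    then have "x = u + j *\<^sub>R (v - u)" by (simp add: algebra_simps)
    then show ?thesis using line_add_scaled_mem[of c u v j] abc lines by simp
  qed
  have x_b: "x \<notin> b"
    using line_eqI[of b c u x] lines abc x_c \<open>u \<noteq> x\<close> by auto
  have y_c: "y \<notin> c"
    using line_eqI[of b c u y] lines abc y_b \<open>u \<noteq> y\<close> by auto
  have tri: "line_triangle M u x y"
    unfolding line_triangle_def using t(1) abc u_t x(2) y_t y_b x_b x_c y_c by blast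
  have "convex hull {u, x, y} \<subseteq> convex hull {u, v, w}"
  proof (rule hull_minimal)
    have "x \<in> convex hull {u, v}"
      using x(1) by (auto simp: segment_convex_hull open_segment_def)
    moreover have "y \<in> convex hull {u, w}"
    proof -
      have "y = (1 - k) *\<^sub>R u + k *\<^sub>R w" by (simp add: y_def algebra_simps)
      then have "y \<in> closed_segment u w"
        unfolding in_segment using k by (intro exI[of _ k]) simp
      then show ?thesis by (simp add: segment_convex_hull)
    qed
    moreover have "convex hull {u, v} \<subseteq> convex hull {u, v, w}"
      "convex hull {u, w} \<subseteq> convex hull {u, v, w}"
      by (intro hull_mono; blast)+
    moreover have "u \<in> convex hull {u, v, w}" by (intro hull_inc) simp
    ultimately show "{u, x, y} \<subseteq> convex hull {u, v, w}" by blast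
  qed simp
  moreover have "convex hull {u, x, y} \<subseteq> {z. n \<bullet> z \<ge> d}"
    using sgn x(2) y_t by (intro hull_minimal convex_halfspace_ge) (auto simp: t(2))
  ultimately show ?thesis using tri sgn by (intro exI[of _ y]) auto
qed

text \<open>A second line \<open>t\<close> through \<open>x\<close> separates \<open>u\<close> from
  \<open>v\<close>, and one of these two corners can be cut off. The other one is an intersection
  point that the new hull loses, so the inclusion is strict.\<close>

lemma line_triangle_side_point_smaller:
  assumes M: "line_arrangement M" and tri: "line_triangle M u v w"
    and x: "x \<in> inter_points M" "x \<in> open_segment u v"
  shows "\<exists>u' v' w'. line_triangle M u' v' w' \<and>
    inter_points M \<inter> convex hull {u', v', w'} \<subset> inter_points M \<inter> convex hull {u, v, w}"
proof -
  have lines: "is_line l" if "l \<in> M" for l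
    using M that by (simp add: line_arrangement_def)
  obtain a b c where abc: "a \<in> M" "b \<in> M" "c \<in> M" "u \<notin> a" "v \<in> a" "w \<in> a" "u \<in> b" "v \<notin> b"
      "w \<in> b" "u \<in> c" "v \<in> c" "w \<notin> c"
    using tri unfolding line_triangle_def by blast
  obtain t where t: "t \<in> M" "t \<noteq> c" "x \<in> t"
    using x(1) unfolding inter_points_def by blast
  obtain j where j: "0 < j" "j < 1" "x = (1 - j) *\<^sub>R u + j *\<^sub>R v"
    using x(2) by (auto simp: in_segment)
  then have "x = u + j *\<^sub>R (v - u)" by (simp add: algebra_simps)
  then have x_c: "x \<in> c" using line_add_scaled_mem[of c u v j] abc lines by simp
  have u_t: "u \<notin> t"
    using line_eqI[of t c u x] lines abc x_c t x(2) by (auto simp: open_segment_def)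
  \<comment> \<open>The normal of \<open>t\<close> is fixed only up to sign, so the claim is proved
    for any normal with \<open>u\<close> on its positive side.\<close>
  have corner: "\<exists>y. line_triangle M u x y \<and> convex hull {u, x, y} \<subseteq> convex hull {u, v, w} - {v}
      \<or> line_triangle M v x y \<and> convex hull {v, x, y} \<subseteq> convex hull {u, v, w} - {u}"
    if nd: "t = {z. n \<bullet> z = d}" and u_pos: "n \<bullet> u > d" for n d
  proof -
    have "(1 - j) * (n \<bullet> u) + j * (n \<bullet> v) = d"
      using t(3) nd j(3) by (simp add: inner_add_right)
    moreover have "(1 - j) * (n \<bullet> u) > (1 - j) * d" using j u_pos by simp
    ultimately have "j * (n \<bullet> v) < j * d" by (simp add: algebra_simps)
    then have v_neg: "n \<bullet> v < d" using j by simp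
    show ?thesis
    proof (cases "n \<bullet> w \<le> d")
      case True
      then show ?thesis
        using line_triangle_cut_corner[OF M abc t(1) nd x(2) t(3) u_pos v_neg] by blast
    next
      case False
      \<comment> \<open>Now \<open>w\<close> is strictly on the side of \<open>u\<close>, so
        \<open>v\<close> is cut off instead: swap \<open>u\<close> with \<open>v\<close> and
        \<open>a\<close> with \<open>b\<close>, and reverse the normal.\<close>
      have "t = {z. (- n) \<bullet> z = - d}" using nd by auto
      from line_triangle_cut_corner[OF M abc(2,1,3,8,7,9,5,4,6,11,10,12) t(1) this, of x]
      show ?thesis
        using x(2) t(3) u_pos v_neg False
        by (auto simp: open_segment_commute insert_commute)
    qed
  qed
  obtain n d where "n \<noteq> 0" and nd: "t = {z. n \<bullet> z = d}"
    using lines[OF t(1)] by (rule is_line_obtain_hyperplane)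
  have nd': "t = {z. (- n) \<bullet> z = - d}" using nd by auto
  have "n \<bullet> u > d \<or> (- n) \<bullet> u > - d" using u_t nd by auto
  then obtain y where y: "line_triangle M u x y \<and>
        convex hull {u, x, y} \<subseteq> convex hull {u, v, w} - {v}
      \<or> line_triangle M v x y \<and> convex hull {v, x, y} \<subseteq> convex hull {u, v, w} - {u}"
    using corner[OF nd] corner[OF nd'] by blast
  have "u \<in> inter_points M" "v \<in> inter_points M"
    using line_triangle_inter_points tri line_triangle_swap by blast+
  moreover have "u \<in> convex hull {u, v, w}" "v \<in> convex hull {u, v, w}"
    by (simp_all add: hull_inc)
  ultimately show ?thesis using y by blast
qed

lemma line_K3_free_no_triangle:
  assumes free: "line_K3_free_graph M"
  shows "\<not> line_triangle M u v w"
proof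
  assume "line_triangle M u v w"
  have M: "line_arrangement M" using free by (simp add: line_K3_free_graph_def)
  define Q where "Q p = (case p of (u, v, w) \<Rightarrow> inter_points M \<inter> convex hull {u, v, w})" for p
  define T where "T p = (case p of (u, v, w) \<Rightarrow> line_triangle M u v w)" for p
  have fin: "finite (Q p)" for p
    using finite_inter_points[OF M] by (simp add: Q_def split: prod.splits)
  have "T (u, v, w)" using \<open>line_triangle M u v w\<close> by (simp add: T_def)
  then obtain p where p: "T p" "\<And>q. T q \<Longrightarrow> card (Q p) \<le> card (Q q)"
    using ex_has_least_nat[of T _ "\<lambda>p. card (Q p)"] by blast
  obtain u v w where p_eq: "p = (u, v, w)" by (cases p)
  have tri: "line_triangle M u v w" using p(1) by (simp add: p_eq T_def)
  have minimal: "\<not> inter_points M \<inter> convex hull {u', v', w'} \<subset> inter_points M \<inter> convex hull {u, v, w}"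
    if "line_triangle M u' v' w'" for u' v' w'
  proof
    assume "inter_points M \<inter> convex hull {u', v', w'} \<subset> inter_points M \<inter> convex hull {u, v, w}"
    then have "card (Q (u', v', w')) < card (Q p)"
      using fin[of p] by (intro psubset_card_mono) (auto simp: Q_def p_eq)
    with p(2)[of "(u', v', w')"] that show False by (simp add: T_def)
  qed
  \<comment> \<open>Stated for reordered corners: the hull depends only on the corner set, so
    minimality carries over to all three sides.\<close>
  have adj: "line_adjacent M u' v'"
    if uvw: "line_triangle M u' v' w'" "{u', v', w'} = {u, v, w}" for u' v' w'
  proof -
    obtain c where "c \<in> M" "u' \<in> c" "v' \<in> c" "u' \<noteq> v'"
      using uvw(1) unfolding line_triangle_def by blast
    moreover have "\<not> (\<exists>x\<in>inter_points M. x \<in> c \<and> x \<in> open_segment u' v')"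
      using line_triangle_side_point_smaller[OF M uvw(1)] minimal unfolding uvw(2) by blast
    ultimately show ?thesis unfolding line_adjacent_def by blast
  qed
  have vwu: "line_triangle M v w u" and wuv: "line_triangle M w u v"
    using tri line_triangle_rotate by blast+
  have "line_adjacent M u v" "line_adjacent M v w" "line_adjacent M w u"
    by (rule adj[OF tri] adj[OF vwu] adj[OF wuv]; auto)+
  moreover have "u \<in> inter_points M" "v \<in> inter_points M" "w \<in> inter_points M"
    using line_triangle_inter_points tri vwu wuv by blast+
  ultimately show False
    using free unfolding line_K3_free_graph_iff by (metis line_adjacent_commute)
qed

text \<open>Otherwise \<open>p\<close> and the points where \<open>c\<close> meets \<open>a\<close>
  and \<open>b\<close> are corners of a triangle.\<close>

lemma line_K3_free_concurrent:
  assumes free: "line_K3_free_graph M" and abc: "a \<in> M" "b \<in> M" "c \<in> M" "a \<noteq> b"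
    and p: "p \<in> a" "p \<in> b" and meet: "a \<inter> c \<noteq> {}" "b \<inter> c \<noteq> {}"
  shows "p \<in> c"
proof (rule ccontr)
  assume "p \<notin> c"
  have lines: "is_line l" if "l \<in> M" for l
    using free that by (simp add: line_K3_free_graph_def line_arrangement_def)
  obtain q r where qr: "q \<in> a" "q \<in> c" "r \<in> b" "r \<in> c" using meet by blast
  have "q \<notin> b" "r \<notin> a"
    using line_eqI[of a b p q] line_eqI[of a b p r] lines abc p qr \<open>p \<notin> c\<close> by blast+
  then have "line_triangle M p q r"
    unfolding line_triangle_def using abc p qr \<open>p \<notin> c\<close> by blast
  with line_K3_free_no_triangle[OF free] show False by blast
qed

section \<open>Colorings of grids and pencils\<close>

text \<open>Disjoint lines meet \<open>b\<close> in different points, each an intersection point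
  since \<open>b\<close> is not in \<open>L\<close>. This supplies the lower bounds on the number of
  colors.\<close>

lemma card_transversal_le_max_points_on:
  assumes M: "line_arrangement M" and b: "b \<in> M" and L: "L \<subseteq> M - {b}" "disjoint L"
    and meet: "\<And>l. l \<in> L \<Longrightarrow> l \<inter> b \<noteq> {}"
  shows "card L \<le> max_points_on M"
proof -
  have "\<exists>x. x \<in> l \<inter> b" if "l \<in> L" for l using meet[OF that] by blast
  then obtain g where g: "\<And>l. l \<in> L \<Longrightarrow> g l \<in> l \<inter> b" by metis
  have "inj_on g L" using g L(2) by (intro inj_onI) (metis IntE disjointD disjoint_iff)
  moreover have "g ` L \<subseteq> {x \<in> inter_points M. x \<in> b}"
  proof (rule image_subsetI)
    fix l assume "l \<in> L"
    with L(1) have "l \<in> M" "l \<noteq> b" by auto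
    with g[OF \<open>l \<in> L\<close>] b show "g l \<in> {x \<in> inter_points M. x \<in> b}"
      unfolding inter_points_def by blast
  qed
  ultimately have "card L \<le> points_on b M"
    unfolding points_on_def using finite_inter_points[OF M] by (intro card_inj_on_le) auto
  also have "\<dots> \<le> max_points_on M"
    unfolding max_points_on_def using M b by (intro Max_ge) (auto simp: line_arrangement_def)
  finally show ?thesis .
qed

text \<open>Each row crosses all columns and conversely, so \<open>k\<close> colors are available.
  Along a row only the column index varies, and it stays below \<open>k\<close>, so no residue
  repeats; likewise along a column.\<close>

lemma EFL_coloring_grid:
  assumes M: "line_arrangement M" and M_eq: "M = A \<union> B" and AB: "A \<inter> B = {}" "A \<noteq> {}" "B \<noteq> {}"
    and disj: "disjoint A" "disjoint B"
    and meet: "\<And>h l. h \<in> A \<Longrightarrow> l \<in> B \<Longrightarrow> h \<inter> l \<noteq> {}"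
  shows "\<exists>f. EFL_coloring M (max_points_on M) f"
proof -
  have fin: "finite A" "finite B" using M M_eq by (auto simp: line_arrangement_def)
  have lines: "is_line l" if "l \<in> M" for l
    using M that by (simp add: line_arrangement_def)
  define k where "k = max (card A) (card B)"
  have "card B \<le> max_points_on M"
  proof -
    obtain h where "h \<in> A" using AB by blast
    then show ?thesis
      using meet AB disj by (intro card_transversal_le_max_points_on[OF M, of h]) (auto simp: M_eq)
  qed
  moreover have "card A \<le> max_points_on M"
  proof -
    obtain l where "l \<in> B" using AB by blast
    then show ?thesis
      using meet AB disj by (intro card_transversal_le_max_points_on[OF M, of l]) (auto simp: M_eq)
  qed
  ultimately have k_le: "k \<le> max_points_on M" by (simp add: k_def)
  \<comment> \<open>As \<open>n mod 0 = n\<close>, positivity of \<open>k\<close> is what bounds the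
    residues.\<close>
  have k_pos: "0 < k" using AB fin by (simp add: k_def card_gt_0_iff less_max_iff_disj)
  obtain i where i: "bij_betw i A {0..<card A}" using ex_bij_betw_finite_nat[OF fin(1)] by blast
  obtain j where j: "bij_betw j B {0..<card B}" using ex_bij_betw_finite_nat[OF fin(2)] by blast
  have i_less: "i h < k" if "h \<in> A" for h
    using bij_betwE[OF i] that by (fastforce simp: k_def)
  have j_less: "j l < k" if "l \<in> B" for l
    using bij_betwE[OF j] that by (fastforce simp: k_def)
  have row_unique: "h = h'" if "h \<in> A" "h' \<in> A" "x \<in> h" "x \<in> h'" for h h' x
    using disjointD[OF disj(1)] that by blast
  have col_unique: "l = l'" if "l \<in> B" "l' \<in> B" "x \<in> l" "x \<in> l'" for l l' x
    using disjointD[OF disj(2)] that by blast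
  \<comment> \<open>Lines of one class are disjoint, so two lines crossing at \<open>x\<close> come
    from different classes.\<close>
  have "\<exists>h l. h \<in> A \<and> l \<in> B \<and> x \<in> h \<and> x \<in> l" if "x \<in> inter_points M" for x
    using that row_unique col_unique unfolding inter_points_def M_eq by blast
  then obtain h l where hl: "\<And>x. x \<in> inter_points M \<Longrightarrow> h x \<in> A \<and> l x \<in> B \<and> x \<in> h x \<and> x \<in> l x"
    by metis
  have point_unique: "x = y"
    if "x \<in> inter_points M" "y \<in> inter_points M" "h x = h y" "l x = l y" for x y
    using line_eqI[of "h x" "l x" x y] lines hl[OF that(1)] hl[OF that(2)] that AB
    by (auto simp: M_eq)
  have shift: "p = q" if "(r + p) mod k = (r + q) mod k" "p < k" "q < k" for r p q :: nat
    using that cong_add_lcancel_nat[of r p q k] by (simp add: cong_def)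
  \<comment> \<open>\<open>Suc\<close> shifts the residues \<open>0..k-1\<close> to the colors
    \<open>1..k\<close>.\<close>
  define f where "f x = Suc ((i (h x) + j (l x)) mod k)" for x
  have "f x \<noteq> f y"
    if xy: "x \<in> inter_points M" "y \<in> inter_points M" "x \<noteq> y" and s: "s \<in> M" "x \<in> s" "y \<in> s"
    for x y s
  proof
    assume eq: "f x = f y"
    note x = hl[OF xy(1)] and y = hl[OF xy(2)]
    have eq': "(i (h x) + j (l x)) mod k = (i (h y) + j (l y)) mod k"
      using eq by (simp add: f_def)
    from s(1) consider "s \<in> A" | "s \<in> B" by (auto simp: M_eq)
    then show False
    proof cases
      case 1
      then have h: "h x = h y" using row_unique[of _ s] x y s(2,3) by metis
      have "j (l x) = j (l y)"
        using shift[of "i (h y)" "j (l x)" "j (l y)"] eq' x y j_less by (simp only: h)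
      then have "l x = l y" using inj_onD[OF bij_betw_imp_inj_on[OF j]] x y by blast
      with h point_unique xy show False by blast
    next
      case 2
      then have l: "l x = l y" using col_unique[of _ s] x y s(2,3) by metis
      have "i (h x) = i (h y)"
        using shift[of "j (l y)" "i (h x)" "i (h y)"] eq' x y i_less
        by (simp only: l add.commute)
      then have "h x = h y" using inj_onD[OF bij_betw_imp_inj_on[OF i]] x y by blast
      with l point_unique xy show False by blast
    qed
  qed
  moreover have "f x \<in> {1..max_points_on M}" for x
    using k_le mod_less_divisor[OF k_pos, of "i (h x) + j (l x)"] by (simp add: f_def)
  ultimately have "EFL_coloring M (max_points_on M) f"
    unfolding EFL_coloring_def by blast
  then show ?thesis by blast
qed

lemma EFL_coloring_pencil:
  assumes M: "line_arrangement M" and p: "\<And>s. s \<in> M \<Longrightarrow> p \<in> s" and ab: "a \<in> M" "b \<in> M" "a \<noteq> b"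
  shows "EFL_coloring M (max_points_on M) (\<lambda>_. 1)"
proof -
  have "x = p" if "x \<in> inter_points M" for x
    using that p line_eqI[of _ _ x p] M unfolding inter_points_def line_arrangement_def by blast
  \<comment> \<open>Every intersection point is \<open>p\<close>; the single transversal
    \<open>b\<close> shows that color \<open>1\<close> is allowed.\<close>
  moreover have "card {b} \<le> max_points_on M"
    using p ab by (intro card_transversal_le_max_points_on[OF M ab(1)]) auto
  ultimately show ?thesis unfolding EFL_coloring_def by auto
qed

section \<open>Structure of the arrangement and the final case split\<close>

text \<open>A transversal \<open>a\<close> of the parallels \<open>b\<close> and \<open>d\<close>
  forces a grid: the rows are the parallel class of \<open>b\<close>, the columns that of
  \<open>a\<close>.\<close>

lemma EFL_coloring_two_parallel:
  assumes free: "line_K3_free_graph M" and abd: "a \<in> M" "b \<in> M" "d \<in> M"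
    and p: "p \<in> a" "p \<in> b" "p \<notin> d" and ab: "a \<noteq> b" and disj: "b \<inter> d = {}"
  shows "\<exists>f. EFL_coloring M (max_points_on M) f"
proof -
  have M: "line_arrangement M" using free by (simp add: line_K3_free_graph_def)
  have lines: "is_line l" if "l \<in> M" for l
    using M that by (simp add: line_arrangement_def)
  have par: "s = r" if "s \<in> M" "r \<in> M" "t \<in> M" "x \<in> s" "x \<in> r" "s \<inter> t = {}" "r \<inter> t = {}" for s r t x
    using parallel_line_unique[of s r t x] lines that by blast
  define A where "A = {l \<in> M. l = b \<or> l \<inter> b = {}}"
  define B where "B = {l \<in> M. l = a \<or> l \<inter> a = {}}"
  \<comment> \<open>A line \<open>l\<close> in neither class crosses \<open>a\<close> and
    \<open>b\<close>, hence also \<open>d\<close>. Concurrency with \<open>a\<close>,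
    \<open>b\<close> puts \<open>p\<close> on \<open>l\<close>, and with \<open>a\<close>,
    \<open>d\<close> it puts \<open>q\<close> on \<open>l\<close>; then
    \<open>l = a\<close>.\<close>
  have "l \<in> B" if l: "l \<in> M" "l \<notin> A" for l
  proof (rule ccontr)
    assume "l \<notin> B"
    then have la: "l \<noteq> a" "l \<inter> a \<noteq> {}" and lb: "l \<noteq> b" "l \<inter> b \<noteq> {}"
      using l by (auto simp: A_def B_def)
    have ad: "a \<inter> d \<noteq> {}" using par[of a b d p] abd p ab disj by blast
    have ld: "l \<inter> d \<noteq> {}" using par[of l b d] l abd lb disj by blast
    obtain q where q: "q \<in> a" "q \<in> d" using ad by blast
    have "p \<in> l" using line_K3_free_concurrent[OF free, of a b l p] abd l la lb p ab by blast
    moreover have "q \<in> l"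
      using line_K3_free_concurrent[OF free, of a d l q] abd l la ld p q by blast
    ultimately show False using line_eqI[of l a p q] lines l abd p q la by blast
  qed
  then have M_eq: "M = A \<union> B" by (auto simp: A_def B_def)
  have "disjoint A" "disjoint B"
  proof -
    have "disjoint {l \<in> M. l = e \<or> l \<inter> e = {}}" if "e \<in> M" for e
    proof (rule disjointI)
      fix l l' assume l: "l \<in> {l \<in> M. l = e \<or> l \<inter> e = {}}" "l' \<in> {l \<in> M. l = e \<or> l \<inter> e = {}}" "l \<noteq> l'"
      show "l \<inter> l' = {}"
      proof (cases "l = e \<or> l' = e")
        case False
        then have "l \<in> M" "l' \<in> M" "l \<inter> e = {}" "l' \<inter> e = {}" using l by auto
        with par[of l l' e] that l(3) show ?thesis by blast
      qed (use l in auto)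
    qed
    then show "disjoint A" "disjoint B" using abd unfolding A_def B_def by blast+
  qed
  moreover have meet: "h \<inter> l \<noteq> {}" if "h \<in> A" "l \<in> B" for h l
  proof
    assume hl: "h \<inter> l = {}"
    \<comment> \<open>A column disjoint from \<open>b\<close> would be parallel to both
      \<open>a\<close> and \<open>b\<close>, which cross at \<open>p\<close>. So it meets
      \<open>b\<close> at some \<open>x\<close>, and a row missing the column would have two
      parallels through \<open>x\<close>.\<close>
    have lb: "l \<inter> b \<noteq> {}" using par[of a b l p] that abd p ab by (auto simp: B_def)
    then obtain x where x: "x \<in> l" "x \<in> b" by blast
    have "h \<noteq> b" using hl x by blast
    then have "l = b" using par[of l b h x] x that hl abd by (auto simp: A_def B_def)
    then show False using that(2) p ab by (auto simp: B_def)
  qed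
  moreover have "A \<inter> B = {}"
  proof -
    have "l \<notin> B" if "l \<in> A" for l
    proof
      assume "l \<in> B"
      with that have "l \<inter> a = {}" "l \<inter> b = {}" using p ab by (auto simp: A_def B_def)
      then show False using par[of a b l p] that abd p ab by (auto simp: A_def)
    qed
    then show ?thesis by blast
  qed
  moreover have "a \<in> B" "b \<in> A" using abd by (auto simp: A_def B_def)
  ultimately show ?thesis using EFL_coloring_grid[OF M M_eq] by blast
qed

theorem theorem10:
  fixes M :: "(real^2) set set"
  assumes "line_K3_free_graph M"
  shows "\<exists>f. EFL_coloring M (max_points_on M) f"
proof (cases "inter_points M = {}")
  case True
  \<comment> \<open>Every function is vacuously a coloring, whatever \<open>max_points_on M\<close>
    is; this covers the empty arrangement, where that value is unspecified.\<close>
  then show ?thesis by (simp add: EFL_coloring_def)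
next
  case False
  have M: "line_arrangement M" using assms by (simp add: line_K3_free_graph_def)
  obtain p a b where ab: "a \<in> M" "b \<in> M" "a \<noteq> b" and p: "p \<in> a" "p \<in> b"
    using False unfolding inter_points_def by blast
  show ?thesis
  proof (cases "\<forall>s\<in>M. p \<in> s")
    case True
    then show ?thesis using EFL_coloring_pencil[OF M _ ab] by blast
  next
    case False
    then obtain d where d: "d \<in> M" "p \<notin> d" by blast
    \<comment> \<open>If \<open>d\<close> crossed both \<open>a\<close> and \<open>b\<close>,
      concurrency would put \<open>p\<close> on it. The two cases differ by exchanging
      \<open>a\<close> and \<open>b\<close>.\<close>
    then consider "a \<inter> d = {}" | "b \<inter> d = {}"
      using line_K3_free_concurrent[OF assms ab(1,2) d(1) ab(3) p] by blast
    then show ?thesis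
    proof cases
      case 1
      then show ?thesis
        using EFL_coloring_two_parallel[OF assms ab(2,1) d(1) p(2,1) d(2)] ab(3) by blast
    next
      case 2
      then show ?thesis
        using EFL_coloring_two_parallel[OF assms ab(1,2) d(1) p d(2)] ab(3) by blast
    qed
  qed
qed

end
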